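(* Let $\mathbb F$ be an algebraically closed field and $V$ a vector space over $\mathbb F$ of dimension $d+1$ with $d\ge3$. Let $\Phi=(A;\{E_i\}_{i=0}^d;A^*;\{E^*_i\}_{i=0}^d)$ be a Leonard system on $V$. Then $0\le\dim{\mathcal Z}(\Phi)\le2$.
   Context: A tridiagonal matrix is irreducible if all entries on its subdiagonal and superdiagonal are nonzero. A Leonard pair on $V$ is an ordered pair $A,A^*\in \mathrm{End}(V)$ such that (i) there is a basis of $V$ with respect to which $A$ is irreducible tridiagonal and $A^*$ is diagonal; (ii) there is a basis of $V$ with respect to which $A^*$ is irreducible tridiagonal and $A$ is diagonal. Then $A,A^*$ are multiplicity-free (diagonalizable with one-dimensional eigenspaces). The primitive idempotent of $A$ for an eigenvalue $\theta$ is the projection onto the $\theta$-eigenspace along the sum of the other eigenspaces. An ordering of the eigenvalues of $A$ (and the corresponding ordering $\{E_i\}_{i=0}^d$ of primitive idempotents) is standard if corresponding eigenvectors $v_0,\dots,v_d$, in this order, form a basis as in (ii). Standard orderings for $A^*$ are defined similarly using (i). A Leonard system on $V$ is a sequence $\Phi=(A;\{E_i\}_{i=0}^d;A^*;\{E^*_i\}_{i=0}^d)$ where $A,A^*$ is a Leonard pair on $V$ and $\{E_i\}$, $\{E^*_i\}$ are standard orderings of the primitive idempotents of $A$, $A^*$. Zero diagonal space: ${\mathcal Z}(\Phi)$ is the set of $X\in\mathrm{Span}\{I,A^*,A,AA^*\}$ such that $E^*_iXE^*_i=0$ for $0\le i\le d$; it is a subspace. Known fact: $I,A^*,A,AA^*,A^*A$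 are linearly independent. *)

theory Defs
  imports
    "HOL-Computational_Algebra.Polynomial"
    "HOL-Library.Function_Algebras"
begin

text \<open>
  The vector space \<open>V\<close> is the whole type \<open>'b\<close> with scalar multiplication \<open>scale\<close>, in the sense
  of the library locale \<open>vector_space\<close>; the definitions are only meant for such \<open>scale\<close>.
  Endomorphisms are functions \<open>'b \<Rightarrow> 'b\<close> satisfying \<open>Vector_Spaces.linear scale scale\<close>; the
  product of \<open>End(V)\<close> is composition, not the pointwise \<open>*\<close> of \<open>Function_Algebras\<close>.
  Sequences \<open>x\<^sub>0, \<dots>, x\<^sub>d\<close> are functions on \<open>nat\<close> of which only the values at \<open>i \<le> d\<close> matter.
\<close>

definition irreducible_tridiagonal :: "nat \<Rightarrow> (nat \<Rightarrow> nat \<Rightarrow> 'a::zero) \<Rightarrow> bool" where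
  "irreducible_tridiagonal d M \<longleftrightarrow>
     (\<forall>i\<le>d. \<forall>j\<le>d. (i + 1 < j \<or> j + 1 < i) \<longrightarrow> M i j = 0) \<and>
     (\<forall>i<d. M i (i + 1) \<noteq> 0 \<and> M (i + 1) i \<noteq> 0)"

definition diagonal_matrix :: "nat \<Rightarrow> (nat \<Rightarrow> nat \<Rightarrow> 'a::zero) \<Rightarrow> bool" where
  "diagonal_matrix d M \<longleftrightarrow> (\<forall>i\<le>d. \<forall>j\<le>d. i \<noteq> j \<longrightarrow> M i j = 0)"

definition ordered_basis ::
  "('a::field \<Rightarrow> 'b::ab_group_add \<Rightarrow> 'b) \<Rightarrow> nat \<Rightarrow> (nat \<Rightarrow> 'b) \<Rightarrow> bool" where
  "ordered_basis scale d v \<longleftrightarrow>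
     inj_on v {..d} \<and> \<not> module.dependent scale (v ` {..d}) \<and>
     module.span scale (v ` {..d}) = UNIV"

text \<open>For an ordered basis \<open>v\<close>, column \<open>j\<close> holds the coordinates of the image of \<open>v j\<close>:
  \<open>X (v j) = (\<Sum>i\<le>d. scale (M i j) (v i))\<close> with \<open>M = matrix_wrt scale d v X\<close>.\<close>

definition matrix_wrt ::
  "('a::field \<Rightarrow> 'b::ab_group_add \<Rightarrow> 'b) \<Rightarrow> nat \<Rightarrow> (nat \<Rightarrow> 'b) \<Rightarrow> ('b \<Rightarrow> 'b) \<Rightarrow> nat \<Rightarrow> nat \<Rightarrow> 'a" where
  "matrix_wrt scale d v X i j = module.representation scale (v ` {..d}) (X (v j)) (v i)"

text \<open>Condition (ii) in the definition of a Leonard pair \<open>A, B\<close> (there is a basis making \<open>B\<close>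
  irreducible tridiagonal and \<open>A\<close> diagonal); condition (i) is the same with \<open>A\<close> and \<open>B\<close>
  exchanged.\<close>

definition leonard_basis ::
  "('a::field \<Rightarrow> 'b::ab_group_add \<Rightarrow> 'b) \<Rightarrow> nat \<Rightarrow> ('b \<Rightarrow> 'b) \<Rightarrow> ('b \<Rightarrow> 'b) \<Rightarrow> (nat \<Rightarrow> 'b) \<Rightarrow> bool" where
  "leonard_basis scale d A B v \<longleftrightarrow>
     ordered_basis scale d v \<and>
     irreducible_tridiagonal d (matrix_wrt scale d v B) \<and>
     diagonal_matrix d (matrix_wrt scale d v A)"

definition leonard_pair ::
  "('a::field \<Rightarrow> 'b::ab_group_add \<Rightarrow> 'b) \<Rightarrow> nat \<Rightarrow> ('b \<Rightarrow> 'b) \<Rightarrow> ('b \<Rightarrow> 'b) \<Rightarrow> bool" where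
  "leonard_pair scale d A B \<longleftrightarrow>
     Vector_Spaces.linear scale scale A \<and> Vector_Spaces.linear scale scale B \<and>
     (\<exists>v. leonard_basis scale d B A v) \<and> (\<exists>v. leonard_basis scale d A B v)"

definition eigenspace ::
  "('a::field \<Rightarrow> 'b::ab_group_add \<Rightarrow> 'b) \<Rightarrow> ('b \<Rightarrow> 'b) \<Rightarrow> 'a \<Rightarrow> 'b set" where
  "eigenspace scale A \<theta> = {v. A v = scale \<theta> v}"

definition eigenvalues ::
  "('a::field \<Rightarrow> 'b::ab_group_add \<Rightarrow> 'b) \<Rightarrow> ('b \<Rightarrow> 'b) \<Rightarrow> 'a set" where
  "eigenvalues scale A = {\<theta>. \<exists>v. v \<noteq> 0 \<and> A v = scale \<theta> v}"

definition is_projection_along ::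
  "('a::field \<Rightarrow> 'b::ab_group_add \<Rightarrow> 'b) \<Rightarrow> ('b \<Rightarrow> 'b) \<Rightarrow> 'b set \<Rightarrow> 'b set \<Rightarrow> bool" where
  "is_projection_along scale E W U \<longleftrightarrow>
     Vector_Spaces.linear scale scale E \<and> E \<circ> E = E \<and> range E = W \<and> {v. E v = 0} = U"

definition is_primitive_idempotent ::
  "('a::field \<Rightarrow> 'b::ab_group_add \<Rightarrow> 'b) \<Rightarrow> ('b \<Rightarrow> 'b) \<Rightarrow> 'a \<Rightarrow> ('b \<Rightarrow> 'b) \<Rightarrow> bool" where
  "is_primitive_idempotent scale A \<theta> E \<longleftrightarrow>
     \<theta> \<in> eigenvalues scale A \<and>
     is_projection_along scale E (eigenspace scale A \<theta>)
       (module.span scale (\<Union>\<eta>\<in>eigenvalues scale A - {\<theta>}. eigenspace scale A \<eta>))"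

definition standard_eigenvalue_ordering ::
  "('a::field \<Rightarrow> 'b::ab_group_add \<Rightarrow> 'b) \<Rightarrow> nat \<Rightarrow> ('b \<Rightarrow> 'b) \<Rightarrow> ('b \<Rightarrow> 'b) \<Rightarrow> (nat \<Rightarrow> 'a) \<Rightarrow> bool" where
  "standard_eigenvalue_ordering scale d A B \<theta> \<longleftrightarrow>
     bij_betw \<theta> {..d} (eigenvalues scale A) \<and>
     (\<exists>v. (\<forall>i\<le>d. v i \<noteq> 0 \<and> A (v i) = scale (\<theta> i) (v i)) \<and> leonard_basis scale d A B v)"

definition standard_idempotent_ordering ::
  "('a::field \<Rightarrow> 'b::ab_group_add \<Rightarrow> 'b) \<Rightarrow> nat \<Rightarrow> ('b \<Rightarrow> 'b) \<Rightarrow> ('b \<Rightarrow> 'b) \<Rightarrow> (nat \<Rightarrow> 'b \<Rightarrow> 'b) \<Rightarrow> bool" where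
  "standard_idempotent_ordering scale d A B E \<longleftrightarrow>
     (\<exists>\<theta>. standard_eigenvalue_ordering scale d A B \<theta> \<and>
          (\<forall>i\<le>d. is_primitive_idempotent scale A (\<theta> i) (E i)))"

definition leonard_system ::
  "('a::field \<Rightarrow> 'b::ab_group_add \<Rightarrow> 'b) \<Rightarrow> nat \<Rightarrow>
    ('b \<Rightarrow> 'b) \<Rightarrow> (nat \<Rightarrow> 'b \<Rightarrow> 'b) \<Rightarrow> ('b \<Rightarrow> 'b) \<Rightarrow> (nat \<Rightarrow> 'b \<Rightarrow> 'b) \<Rightarrow> bool" where
  "leonard_system scale d A E As Es \<longleftrightarrow>
     leonard_pair scale d A As \<and>
     standard_idempotent_ordering scale d A As E \<and>
     standard_idempotent_ordering scale d As A Es"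

definition end_scale ::
  "('a::field \<Rightarrow> 'b::ab_group_add \<Rightarrow> 'b) \<Rightarrow> 'a \<Rightarrow> ('b \<Rightarrow> 'b) \<Rightarrow> ('b \<Rightarrow> 'b)" where
  "end_scale scale c X = (\<lambda>v. scale c (X v))"

text \<open>\<open>End(V)\<close> is treated as a subspace of the space of all functions on \<open>V\<close>; spans and
  dimensions of sets of endomorphisms are the same in both.\<close>

lemma vector_space_end_scale:
  assumes "vector_space scale"
  shows "vector_space (end_scale scale)"
proof -
  interpret vector_space scale by fact
  show ?thesis
    by unfold_locales
      (auto simp: end_scale_def fun_eq_iff scale_right_distrib scale_left_distrib)
qed

definition zero_diagonal_space ::
  "('a::field \<Rightarrow> 'b::ab_group_add \<Rightarrow> 'b) \<Rightarrow> nat \<Rightarrow>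
    ('b \<Rightarrow> 'b) \<Rightarrow> (nat \<Rightarrow> 'b \<Rightarrow> 'b) \<Rightarrow> ('b \<Rightarrow> 'b) \<Rightarrow> (nat \<Rightarrow> 'b \<Rightarrow> 'b) \<Rightarrow> ('b \<Rightarrow> 'b) set" where
  "zero_diagonal_space scale d A E As Es =
     {X \<in> module.span (end_scale scale) {id, As, A, A \<circ> As}.
        \<forall>i\<le>d. Es i \<circ> X \<circ> Es i = (\<lambda>_. 0)}"

lemma subspace_zero_diagonal_space:
  assumes "vector_space scale" and "leonard_system scale d A E As Es"
  shows "module.subspace (end_scale scale) (zero_diagonal_space scale d A E As Es)"
proof -
  interpret vector_space scale by fact
  interpret End: vector_space "end_scale scale"
    by (rule vector_space_end_scale) fact
  have lin: "Vector_Spaces.linear scale scale (Es i)" if "i \<le> d" for i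
    using assms(2) that
    by (auto simp: leonard_system_def standard_idempotent_ordering_def
        is_primitive_idempotent_def is_projection_along_def)
  have Es: "Es i 0 = 0" "Es i (x + y) = Es i x + Es i y" "Es i (scale c x) = scale c (Es i x)"
    if "i \<le> d" for i x y c
  proof -
    interpret L: Vector_Spaces.linear scale scale "Es i" by (rule lin[OF that])
    show "Es i 0 = 0" "Es i (x + y) = Es i x + Es i y" "Es i (scale c x) = scale c (Es i x)"
      by (rule L.zero L.add L.scale)+
  qed
  have "Es i \<circ> end_scale scale c X \<circ> Es i = (\<lambda>_. 0)"
    if "i \<le> d" "Es i \<circ> X \<circ> Es i = (\<lambda>_. 0)" for i c X
    using that by (simp add: fun_eq_iff end_scale_def Es)
  then show ?thesis
    unfolding zero_diagonal_space_def End.subspace_def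
    by (auto simp: End.span_zero End.span_add End.span_scale fun_eq_iff Es)
qed

end

theory Submission
  imports Defs
begin

text \<open>
  No element \<open>A\<^sup>* - k I\<close> and no nonzero multiple of \<open>I\<close> has zero diagonal, because the
  diagonal entries of \<open>A\<^sup>*\<close> are its pairwise distinct eigenvalues. Hence \<open>I\<close> and \<open>A\<^sup>*\<close> extend a
  basis of the zero diagonal space to an independent subset of a space spanned by four elements.
\<close>

text \<open>Since \<open>\<theta>\<close> is an eigenvalue, its eigenspace contains a nonzero
  vector. That eigenspace is the range of \<open>E\<close>, and an idempotent map fixes every point
  of its range.\<close>

lemma primitive_idempotent_fixes_eigenvector:
  assumes "is_primitive_idempotent scale B \<theta> E"
  obtains w where "w \<noteq> 0" "E w = w" "B w = scale \<theta> w"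
proof -
  from assms obtain w where w: "w \<noteq> 0" "B w = scale \<theta> w"
    by (auto simp: is_primitive_idempotent_def eigenvalues_def)
  from assms have E: "E \<circ> E = E" "range E = eigenspace scale B \<theta>"
    by (auto simp: is_primitive_idempotent_def is_projection_along_def)
  have "w \<in> range E"
    using w(2) by (simp add: E(2) eigenspace_def)
  then have "E w = w"
    using E(1) by (metis comp_apply rangeE)
  with w show thesis by (blast intro: that)
qed

text \<open>Index 0 already decides: zero diagonal would force \<open>Es 0 \<circ> Es 0\<close> to
  vanish, although \<open>Es 0\<close> fixes a nonzero vector.\<close>

lemma id_notin_zero_diagonal_space:
  assumes "leonard_system scale d A E As Es"
  shows "id \<notin> zero_diagonal_space scale d A E As Es"
proof
  assume "id \<in> zero_diagonal_space scale d A E As Es"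
  then have "Es 0 (Es 0 v) = 0" for v
    by (auto simp: zero_diagonal_space_def fun_eq_iff)
  moreover obtain \<theta> where "is_primitive_idempotent scale As (\<theta> 0) (Es 0)"
    using assms by (auto simp: leonard_system_def standard_idempotent_ordering_def)
  then obtain w where "w \<noteq> 0" "Es 0 w = w"
    by (rule primitive_idempotent_fixes_eigenvector)
  ultimately show False by metis
qed

lemma dual_minus_scalar_notin_zero_diagonal_space:
  assumes "vector_space scale" and "leonard_system scale d A E As Es" and "d \<ge> 1"
  shows "As - end_scale scale k id \<notin> zero_diagonal_space scale d A E As Es"
proof
  interpret vector_space scale by fact
  assume Z: "As - end_scale scale k id \<in> zero_diagonal_space scale d A E As Es"
  obtain \<theta> where inj: "inj_on \<theta> {..d}"
    and E: "\<And>i. i \<le> d \<Longrightarrow> is_primitive_idempotent scale As (\<theta> i) (Es i)"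
    using assms(2)
    by (auto simp: leonard_system_def standard_idempotent_ordering_def
        standard_eigenvalue_ordering_def bij_betw_def)
  have "\<theta> i = k" if i: "i \<le> d" for i
  proof -
    obtain w where w: "w \<noteq> 0" "Es i w = w" "As w = scale (\<theta> i) w"
      using E[OF i] by (rule primitive_idempotent_fixes_eigenvector)
    interpret L: Vector_Spaces.linear scale scale "Es i"
      using E[OF i] by (simp add: is_primitive_idempotent_def is_projection_along_def)
    \<comment> \<open>The zero diagonal condition is evaluated at the eigenvector \<open>w\<close>,
      on which the compression by \<open>Es i\<close> acts as the scalar
      \<open>\<theta> i - k\<close>.\<close>
    have "0 = Es i ((As - end_scale scale k id) (Es i w))"
      using Z i by (auto simp: zero_diagonal_space_def fun_eq_iff)
    also have "\<dots> = scale (\<theta> i - k) w"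
      by (simp add: w end_scale_def L.diff L.scale scale_left_diff_distrib)
    finally show ?thesis using w(1) by simp
  qed
  from this[of 0] this[of 1] assms(3) have "\<theta> 0 = \<theta> 1" by simp
  with inj assms(3) show False by (auto dest: inj_onD)
qed

theorem lemma5p7:
  fixes scale :: "'a::alg_closed_field \<Rightarrow> 'v::ab_group_add \<Rightarrow> 'v"
    and A As :: "'v \<Rightarrow> 'v"
    and E Es :: "nat \<Rightarrow> 'v \<Rightarrow> 'v"
    and d :: nat
  assumes "vector_space scale"
    and "vector_space.dim scale UNIV = d + 1"
    and "d \<ge> 3"
    and "leonard_system scale d A E As Es"
  shows "0 \<le> vector_space.dim (end_scale scale) (zero_diagonal_space scale d A E As Es) \<and>
         vector_space.dim (end_scale scale) (zero_diagonal_space scale d A E As Es) \<le> 2"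
proof -
  interpret End: vector_space "end_scale scale"
    by (rule vector_space_end_scale) fact
  let ?Z = "zero_diagonal_space scale d A E As Es"
  let ?S = "{id, As, A, A \<circ> As}"
  have sub: "End.subspace ?Z"
    using assms(1,4) by (rule subspace_zero_diagonal_space)
  obtain B where B: "B \<subseteq> ?Z" "End.independent B" "card B = End.dim ?Z"
    using End.basis_exists by metis
  have spanB: "End.span B \<subseteq> ?Z"
    using B(1) sub by (rule End.span_minimal)
  have id: "id \<notin> End.span B"
    using spanB id_notin_zero_diagonal_space[OF assms(4)] by blast
  \<comment> \<open>If \<open>As\<close> were in this span, splitting off the multiple of
    \<open>id\<close> would put some \<open>As - k id\<close> into the span of \<open>B\<close>,
    hence into \<open>?Z\<close>.\<close>
  have As: "As \<notin> End.span (insert id B)"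
    using spanB dual_minus_scalar_notin_zero_diagonal_space[OF assms(1,4)] assms(3)
    by (auto simp: End.span_breakdown_eq)
  have "End.independent (insert As (insert id B))"
    using B(2) id As by (simp add: End.independent_insertI)
  moreover have "insert As (insert id B) \<subseteq> End.span ?S"
    using B(1) by (auto simp: zero_diagonal_space_def intro: End.span_base)
  \<comment> \<open>Exchange bound: an independent set inside the span of a finite set is finite and
    no larger. Finiteness matters because \<open>card\<close> is 0 on infinite sets.\<close>
  ultimately have fin: "finite (insert As (insert id B))"
    and "card (insert As (insert id B)) \<le> card ?S"
    using End.independent_span_bound[of ?S "insert As (insert id B)"] by auto
  moreover have "card ?S \<le> 4"
    using card_length[of "[id, As, A, A \<circ> As]"] by simp
  \<comment> \<open>Both insertions add a new element, as each set is contained in its own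
    span.\<close>
  moreover have "card (insert As (insert id B)) = card B + 2"
    using fin id As End.span_base[of _ B] End.span_base[of _ "insert id B"]
    by (subst card_insert_disjoint; force)
  ultimately show ?thesis using B(3) by simp
qed

end
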